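(* Let $\mathbb{F}$ be a field and let $L$ be any minimal symplectic alternating algebra over $\mathbb{F}$ of dimension $2n\le 16$. Let $m\geq 0$ be the integer with $\Omega(m)<n\le \Omega(m+1)$. Then the nilpotency class of $L$ is at most $7$, and it is given by $$\mathrm{class}(L)=\begin{cases}2m+1, & \text{if } \Omega(m)<n\le \dfrac{\Omega(m)+\Omega(m+1)}{2},\\[2mm] 2m+2, & \text{if } \dfrac{\Omega(m)+\Omega(m+1)}{2}<n\le \Omega(m+1).\end{cases}$$
   Context: A symplectic alternating algebra over a field $\mathbb{F}$ is a finite-dimensional $\mathbb{F}$-vector space $L$ (necessarily of even dimension $2n$) equipped with a non-degenerate alternating bilinear form $(\ ,\ ):L\times L\to\mathbb{F}$ and an alternating bilinear product $L\times L\to L$, $(x,y)\mapsto x\cdot y$ (so $x\cdot x=0$ for all $x$), such that $(x\cdot y,z)=(y\cdot z,x)$ for all $x,y,z\in L$. The product is not assumed associative. $L$ is nilpotent if there is an ascending chain of ideals $\{0\}=I_0\le I_1\le\cdots\le I_k=L$ with $I_sL\le I_{s-1}$ for $s=1,\ldots,k$; the smallest possible $k$ is the nilpotency class, $\mathrm{class}(L)$. Here, for subspaces $U,V$ of $L$, $UV$ denotes the linear span of all products $u\cdot v$ with $u\in U$, $v\in V$. The centre of $L$ is $Z(L)=\{x\in L: x\cdot y=0 \text{ for all } y\in L\}$. The rank of a nilpotent symplectic alternating algebra $L$ is the number of elements in a minimal set of generators of $L$ as an algebra; it equals $\dim L-\dim L^2=\dim Z(L)$, where $L^2=LL$. A symplectic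 alternating algebra $L$ of dimension $2n$ over $\mathbb{F}$ is called minimal if it is nilpotent of rank $2$ and its nilpotency class is the minimum of the nilpotency classes of all nilpotent symplectic alternating algebras of rank $2$ and dimension $2n$ over $\mathbb{F}$. The function $\Omega:\mathbb{N}\to\mathbb{N}$ (with $0\in\mathbb{N}$) is defined recursively by $\Omega(0)=0$ and $\Omega(m+1)=2+\binom{\Omega(m)}{2}$; thus $\Omega(1)=2$, $\Omega(2)=3$, $\Omega(3)=5$, $\Omega(4)=12$. *)

theory Defs
  imports Complex_Main
begin

locale symplectic_alternating_algebra =
  vector_space scale
  for scale :: "'a::field \<Rightarrow> 'v::ab_group_add \<Rightarrow> 'v" +
  fixes form :: "'v \<Rightarrow> 'v \<Rightarrow> 'a"
    and mult :: "'v \<Rightarrow> 'v \<Rightarrow> 'v" (infixl "\<cdot>" 70)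
  assumes finite_dim: "\<exists>B. finite B \<and> span B = UNIV"
    and form_linear_right: "Vector_Spaces.linear scale (*) (\<lambda>y. form x y)"
    and form_linear_left: "Vector_Spaces.linear scale (*) (\<lambda>x. form x y)"
    and form_alternating: "form x x = 0"
    and form_nondegenerate: "(\<And>y. form x y = 0) \<Longrightarrow> x = 0"
    and mult_linear_right: "Vector_Spaces.linear scale scale (\<lambda>y. x \<cdot> y)"
    and mult_linear_left: "Vector_Spaces.linear scale scale (\<lambda>x. x \<cdot> y)"
    and mult_alternating: "x \<cdot> x = 0"
    and form_mult_cyclic: "form (x \<cdot> y) z = form (y \<cdot> z) x"
begin

definition set_mult :: "'v set \<Rightarrow> 'v set \<Rightarrow> 'v set" where
  "set_mult U V = span {u \<cdot> v | u v. u \<in> U \<and> v \<in> V}"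

definition is_ideal :: "'v set \<Rightarrow> bool" where
  "is_ideal I \<longleftrightarrow> subspace I \<and> set_mult I UNIV \<subseteq> I \<and> set_mult UNIV I \<subseteq> I"

text \<open>Only the values \<open>I 0, \<dots>, I k\<close> of the function \<open>I\<close> matter.\<close>

definition nilpotency_chain :: "nat \<Rightarrow> (nat \<Rightarrow> 'v set) \<Rightarrow> bool" where
  "nilpotency_chain k I \<longleftrightarrow>
     I 0 = {0} \<and> I k = UNIV \<and>
     (\<forall>s\<le>k. is_ideal (I s)) \<and>
     (\<forall>s\<in>{1..k}. I (s - 1) \<subseteq> I s) \<and>
     (\<forall>s\<in>{1..k}. set_mult (I s) UNIV \<subseteq> I (s - 1))"

definition nilpotent_algebra :: bool where
  "nilpotent_algebra \<longleftrightarrow> (\<exists>k I. nilpotency_chain k I)"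

definition nilpotency_class :: nat where
  "nilpotency_class = (LEAST k. \<exists>I. nilpotency_chain k I)"

definition is_subalgebra :: "'v set \<Rightarrow> bool" where
  "is_subalgebra A \<longleftrightarrow> subspace A \<and> (\<forall>x\<in>A. \<forall>y\<in>A. x \<cdot> y \<in> A)"

definition algebra_rank :: nat where
  "algebra_rank = (LEAST r. \<exists>X. finite X \<and> card X = r \<and> is_subalgebra hull X = UNIV)"

end

text \<open>
  The competitors of an algebra \<open>L\<close> with underlying type \<open>'v\<close> are all nilpotent algebras of rank 2
  and of the same dimension over \<open>'a\<close> whose underlying type is again \<open>'v\<close>, with arbitrary scalar
  multiplication, form and product. Since all \<open>2n\<close>-dimensional vector spaces over \<open>'a\<close> are
  isomorphic and class and rank are invariant under isomorphism, every such algebra on another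
  type is isomorphic to one of these competitors.
\<close>

definition minimal_symplectic_alternating_algebra ::
    "('a::field \<Rightarrow> 'v::ab_group_add \<Rightarrow> 'v) \<Rightarrow> ('v \<Rightarrow> 'v \<Rightarrow> 'a) \<Rightarrow> ('v \<Rightarrow> 'v \<Rightarrow> 'v) \<Rightarrow> bool" where
  "minimal_symplectic_alternating_algebra scale form mult \<longleftrightarrow>
     symplectic_alternating_algebra scale form mult \<and>
     symplectic_alternating_algebra.nilpotent_algebra scale mult \<and>
     symplectic_alternating_algebra.algebra_rank scale mult = 2 \<and>
     (\<forall>(scale' :: 'a \<Rightarrow> 'v \<Rightarrow> 'v) (form' :: 'v \<Rightarrow> 'v \<Rightarrow> 'a) (mult' :: 'v \<Rightarrow> 'v \<Rightarrow> 'v).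
        symplectic_alternating_algebra scale' form' mult' \<and>
        symplectic_alternating_algebra.nilpotent_algebra scale' mult' \<and>
        symplectic_alternating_algebra.algebra_rank scale' mult' = 2 \<and>
        vector_space.dim scale' (UNIV :: 'v set) = vector_space.dim scale (UNIV :: 'v set) \<longrightarrow>
        symplectic_alternating_algebra.nilpotency_class scale mult
          \<le> symplectic_alternating_algebra.nilpotency_class scale' mult')"

fun Omega :: "nat \<Rightarrow> nat" where
  "Omega 0 = 0"
| "Omega (Suc m) = 2 + (Omega m choose 2)"

lemma Omega_less_Suc: "Omega m < Omega (Suc m)"
proof -
  have "k < 2 + (k choose 2)" for k :: nat
  proof (induction k)
    case (Suc k)
    then show ?case by (cases k) (auto simp: numeral_2_eq_2)
  qed simp
  then show ?thesis by simp
qed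

lemma ex1_Omega_interval:
  assumes "0 < n"
  shows "\<exists>!m. Omega m < n \<and> n \<le> Omega (m + 1)"
proof -
  have mono: "strict_mono Omega"
    by (simp add: strict_mono_Suc_iff Omega_less_Suc del: Omega.simps)
  define k where "k = (LEAST k. n \<le> Omega k)"
  have k: "n \<le> Omega k"
    unfolding k_def by (rule LeastI[of _ n]) (rule strict_mono_imp_increasing[OF mono])
  with assms obtain m where m: "k = Suc m" by (cases k) auto
  then have "\<not> n \<le> Omega m" using not_less_Least[of m "\<lambda>k. n \<le> Omega k"] by (simp add: k_def)
  moreover have "j = m" if "Omega j < n \<and> n \<le> Omega (j + 1)" for j
  proof -
    have "j < k" "m < Suc j"
      using that k \<open>\<not> n \<le> Omega m\<close> strict_mono_less[OF mono]
      by (metis Suc_eq_plus1 le_less_trans less_le_trans not_le)+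
    then show ?thesis using m by simp
  qed
  ultimately show ?thesis using k m by (metis Suc_eq_plus1 not_le)
qed

end

theory Submission imports Defs begin

text \<open>Let \<open>L\<^sup>k\<close> be the lower central series and \<open>c\<close> the class. If \<open>L\<close> has rank 2, then \<open>L / L\<^sup>2\<close> is
  spanned by two elements and \<open>L\<^sup>2 / L\<^bsup>k+2\<^esup>\<close> by the products of pairs of generators of \<open>L / L\<^bsup>k+1\<^esup>\<close>,
  whence \<open>dim (L / L\<^bsup>k+1\<^esup>) \<le> \<Omega>(k)\<close>. As \<open>L\<^bsup>i+1\<^esup>\<close> and \<open>L\<^bsup>j+1\<^esup>\<close> are orthogonal for \<open>i + j \<ge> c\<close>, nondegeneracy
  gives \<open>2n \<le> \<Omega>(i) + \<Omega>(j)\<close>, and \<open>i = \<lfloor>c/2\<rfloor>\<close>, \<open>j = \<lceil>c/2\<rceil>\<close> is the lower bound on the class. It is attained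
  for \<open>n = 1, 4, \<dots>, 8\<close> by algebras whose alternating trilinear form \<open>(xy, z)\<close> is a sum of a few
  coordinate determinants. For \<open>n = 2, 3\<close> there is no nilpotent algebra of rank 2: its trilinear
  form would be nondegenerate on \<open>L / Z(L)\<close>, which has dimension at most 4, although it vanishes on
  the independent vectors \<open>a, b, ab\<close>, where \<open>a, b\<close> generate \<open>L\<close>.\<close>

section \<open>The lower central series and the lower bound\<close>

context symplectic_alternating_algebra
begin

section \<open>Bilinearity and skew-symmetry\<close>

lemma form_add_left: "form (x + y) z = form x z + form y z"
  and form_scale_left: "form (scale c x) z = c * form x z"
  using form_linear_left by (auto simp: Vector_Spaces.linear_iff)

lemma form_add_right: "form x (y + z) = form x y + form x z"
  and form_scale_right: "form x (scale c y) = c * form x y"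
  using form_linear_right by (auto simp: Vector_Spaces.linear_iff)

lemma mult_add_left: "(x + y) \<cdot> z = x \<cdot> z + y \<cdot> z"
  and mult_scale_left: "scale c x \<cdot> z = scale c (x \<cdot> z)"
  using mult_linear_left by (auto simp: Vector_Spaces.linear_iff)

lemma mult_add_right: "x \<cdot> (y + z) = x \<cdot> y + x \<cdot> z"
  and mult_scale_right: "x \<cdot> scale c y = scale c (x \<cdot> y)"
  using mult_linear_right by (auto simp: Vector_Spaces.linear_iff)

lemma form_zero_left [simp]: "form 0 x = 0"
  using form_scale_left[of 0 0 x] by simp

lemma form_zero_right [simp]: "form x 0 = 0"
  using form_scale_right[of x 0 0] by simp

lemma mult_zero_left [simp]: "0 \<cdot> x = 0"
  using mult_scale_left[of 0 0 x] by simp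

lemma mult_zero_right [simp]: "x \<cdot> 0 = 0"
  using mult_scale_right[of x 0 0] by simp

lemma form_skew: "form x y = - form y x"
  using form_alternating[of "x + y"] form_alternating[of x] form_alternating[of y]
  by (simp add: form_add_left form_add_right eq_neg_iff_add_eq_0 add.commute)

lemma mult_skew: "x \<cdot> y = - (y \<cdot> x)"
  using mult_alternating[of "x + y"] mult_alternating[of x] mult_alternating[of y]
  by (simp add: mult_add_left mult_add_right eq_neg_iff_add_eq_0 add.commute)

lemma form_diff_left: "form (x - y) z = form x z - form y z"
  using form_add_left[of "x - y" y z] by simp

lemma form_eq_zero_commute: "form x y = 0 \<longleftrightarrow> form y x = 0"
  using form_skew[of x y] by simp

section \<open>Finite dimension and annihilators\<close>

definition some_basis :: "'v set" where
  "some_basis = (SOME B. finite B \<and> independent B \<and> span B = UNIV)"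

sublocale finite_dimensional_vector_space scale some_basis
proof -
  obtain C where C: "finite C" "span C = UNIV" using finite_dim by blast
  obtain B where B: "B \<subseteq> C" "independent B" "C \<subseteq> span B"
    using maximal_independent_subset by blast
  then have "finite B \<and> independent B \<and> span B = UNIV"
    using C by (metis finite_subset span_mono span_span top.extremum_uniqueI)
  then have "finite some_basis \<and> independent some_basis \<and> span some_basis = UNIV"
    unfolding some_basis_def by (rule someI)
  then show "finite_dimensional_vector_space scale some_basis"
    by unfold_locales auto
qed

text \<open>Each condition \<open>form x t = 0\<close> is one linear equation and cuts the dimension
  by at most one: subtracting a multiple of a vector \<open>w\<close> that violates it brings every
  vector into the solution space.\<close>

lemma dim_le_dim_annihilator:
  assumes "finite T" "subspace U"
  shows "dim U \<le> dim {x \<in> U. \<forall>t\<in>T. form x t = 0} + card T"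
  using assms(1)
proof (induction T)
  case empty
  show ?case by simp
next
  case (insert t T)
  let ?W = "{x \<in> U. \<forall>t\<in>T. form x t = 0}"
  let ?W' = "{x \<in> U. \<forall>s\<in>insert t T. form x s = 0}"
  have "dim ?W \<le> dim ?W' + 1"
  proof (cases "\<exists>w\<in>?W. form w t \<noteq> 0")
    case True
    then obtain w where w: "w \<in> ?W" "form w t \<noteq> 0" by blast
    have "x \<in> span (insert w ?W')" if "x \<in> ?W" for x
    proof -
      define k where "k = form x t / form w t"
      have "x - scale k w \<in> ?W'"
        using that w assms(2)
        by (auto simp: form_diff_left form_scale_left k_def subspace_scale subspace_diff)
      then have "x - scale k w \<in> span ?W'" by (rule span_base)
      then show ?thesis unfolding span_breakdown_eq by (rule exI)
    qed
    then have "dim ?W \<le> dim (insert w ?W')" by (intro dim_mono) blast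
    then show ?thesis by (simp add: dim_insert split: if_splits)
  next
    case False
    then have "?W = ?W'" by auto
    then show ?thesis by simp
  qed
  then show ?case using insert by simp
qed

lemma form_span_eq_zero:
  assumes "\<And>t. t \<in> T \<Longrightarrow> form x t = 0" "y \<in> span T"
  shows "form x y = 0"
  using assms(2) by (induction rule: span_induct_alt)
    (auto simp: assms(1) form_add_right form_scale_right)

section \<open>Products of subspaces and the lower central series\<close>

lemma mult_mem_set_mult: "u \<in> U \<Longrightarrow> v \<in> V \<Longrightarrow> u \<cdot> v \<in> set_mult U V"
  unfolding set_mult_def by (intro span_base) blast

lemma set_mult_mono: "U \<subseteq> U' \<Longrightarrow> V \<subseteq> V' \<Longrightarrow> set_mult U V \<subseteq> set_mult U' V'"
  unfolding set_mult_def by (intro span_mono) blast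

lemma set_mult_subset:
  assumes "subspace W" "\<And>u v. u \<in> U \<Longrightarrow> v \<in> V \<Longrightarrow> u \<cdot> v \<in> W"
  shows "set_mult U V \<subseteq> W"
  unfolding set_mult_def using assms by (intro span_minimal) auto

text \<open>Indexed from \<open>0\<close>: \<open>lcs k\<close> is usually written \<open>L\<^bsup>k+1\<^esup>\<close>.\<close>

fun lcs :: "nat \<Rightarrow> 'v set" where
  "lcs 0 = UNIV"
| "lcs (Suc k) = set_mult (lcs k) UNIV"

lemma subspace_lcs: "subspace (lcs k)"
  by (cases k) (auto simp: set_mult_def)

lemma span_lcs [simp]: "span (lcs k) = lcs k"
  by (simp add: span_eq_iff subspace_lcs)

lemma mult_mem_lcs_left: "x \<in> lcs k \<Longrightarrow> x \<cdot> y \<in> lcs (Suc k)"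
  by (simp add: mult_mem_set_mult)

lemma mult_mem_lcs_right: "y \<in> lcs k \<Longrightarrow> x \<cdot> y \<in> lcs (Suc k)"
  using mult_mem_lcs_left[of y k x] mult_skew[of x y] subspace_neg[OF subspace_lcs] by metis

lemma lcs_Suc_subset: "lcs (Suc k) \<subseteq> lcs k"
proof (induction k)
  case (Suc k)
  then have "set_mult (lcs (Suc k)) UNIV \<subseteq> set_mult (lcs k) UNIV" by (intro set_mult_mono) simp_all
  then show ?case by simp
qed simp

lemma lcs_antimono: "i \<le> j \<Longrightarrow> lcs j \<subseteq> lcs i"
  by (rule lift_Suc_antimono_le[of lcs, OF lcs_Suc_subset])

text \<open>Multiplying by the whole algebra moves one step down in both families, so the lower
  central series descends at least as fast as any chain.\<close>

lemma nilpotency_chain_lcs: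
  assumes "nilpotency_chain k I" "j \<le> k"
  shows "lcs j \<subseteq> I (k - j)"
  using assms(2)
proof (induction j)
  case 0
  then show ?case using assms(1) by (simp add: nilpotency_chain_def)
next
  case (Suc j)
  have "lcs (Suc j) \<subseteq> set_mult (I (k - j)) UNIV"
    using Suc set_mult_mono[of "lcs j" "I (k - j)" UNIV UNIV] by simp
  moreover have "k - j \<in> {1..k}" using Suc.prems by auto
  then have "set_mult (I (k - j)) UNIV \<subseteq> I (k - j - 1)"
    using assms(1) unfolding nilpotency_chain_def by blast
  ultimately show ?case by simp
qed

lemma nilpotency_chain_lcs_eq_0:
  assumes "nilpotency_chain k I"
  shows "lcs k = {0}"
  using nilpotency_chain_lcs[OF assms order_refl] assms subspace_0[OF subspace_lcs, of k]
  by (auto simp: nilpotency_chain_def)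

text \<open>Up to sign the cyclic law turns \<open>form (u \<cdot> v) y\<close> into
  \<open>form u (v \<cdot> y)\<close>, which trades one step of \<open>i\<close> for one of
  \<open>j\<close>; at \<open>i = 0\<close> the second argument lies in
  \<open>lcs k\<close>.\<close>

lemma form_lcs_lcs:
  assumes "lcs k = {0}" "x \<in> lcs i" "y \<in> lcs j" "k \<le> i + j"
  shows "form x y = 0"
  using assms(2-4)
proof (induction i arbitrary: x y j)
  case 0
  then show ?case using lcs_antimono[of k j] assms(1) by auto
next
  case (Suc i)
  have "form y (u \<cdot> v) = 0" if "u \<in> lcs i" for u v
  proof -
    have "form u (v \<cdot> y) = 0"
      using that Suc.prems by (intro Suc.IH[of _ _ "Suc j"] mult_mem_lcs_right) auto
    then show ?thesis using form_mult_cyclic[of u v y] form_eq_zero_commute by metis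
  qed
  then have "form y x = 0"
    using Suc.prems(1) by (intro form_span_eq_zero[of _ y x]) (auto simp: set_mult_def)
  then show ?case by (simp add: form_eq_zero_commute)
qed

text \<open>A vector of \<open>U\<close> orthogonal to \<open>T\<close> is orthogonal to the
  spanning set \<open>T \<union> V\<close>, hence zero. So \<open>U\<close> has dimension at most
  \<open>card T\<close>, and \<open>S\<close> supplies the rest.\<close>

lemma dim_UNIV_le_card_add_card:
  assumes "finite S" "finite T"
    and "span (S \<union> U) = UNIV" "span (T \<union> V) = UNIV" "subspace U"
    and orth: "\<And>u v. u \<in> U \<Longrightarrow> v \<in> V \<Longrightarrow> form u v = 0"
  shows "dim (UNIV :: 'v set) \<le> card S + card T"
proof -
  have "x = 0" if "x \<in> U" "\<forall>t\<in>T. form x t = 0" for x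
  proof (rule form_nondegenerate)
    show "form x y = 0" for y
      using that orth assms(4) by (intro form_span_eq_zero[of "T \<union> V" x y]) auto
  qed
  then have "{x \<in> U. \<forall>t\<in>T. form x t = 0} \<subseteq> {0}" by blast
  then have "dim {x \<in> U. \<forall>t\<in>T. form x t = 0} = 0" by (simp only: dim_eq_0)
  then have "dim U \<le> card T"
    using dim_le_dim_annihilator[OF assms(2,5)] by linarith
  moreover have "dim (S \<union> U) \<le> card S + dim U"
    using assms(1)
  proof (induction S)
    case (insert s S)
    then show ?case by (simp add: dim_insert)
  qed simp
  ultimately show ?thesis using dim_span[of "S \<union> U"] assms(3) by simp
qed

section \<open>Counting generators modulo the lower central series\<close>

lemma span_gen_Un_lcs:
  assumes "is_subalgebra hull X = UNIV"
  shows "span (X \<union> lcs 1) = UNIV"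
proof -
  have "is_subalgebra (span (X \<union> lcs 1))"
    unfolding is_subalgebra_def
    by (simp add: span_base mult_mem_set_mult)
  then have "is_subalgebra hull X \<subseteq> span (X \<union> lcs 1)"
    by (intro hull_minimal) (auto intro: span_base)
  then show ?thesis using assms by auto
qed

lemma mem_span_Un_subspace:
  assumes "subspace V" "x \<in> span (S \<union> V)"
  obtains s v where "s \<in> span S" "v \<in> V" "x = s + v"
  using assms span_Un[of S V] span_eq_iff[THEN iffD2, of V] by auto

text \<open>Modulo \<open>lcs (Suc k)\<close> a product depends only on the residues modulo \<open>lcs k\<close> of its factors.\<close>

lemma mult_mem_span_products:
  assumes span: "span (S \<union> lcs k) = UNIV"
    and P: "subspace P" "lcs (Suc k) \<subseteq> P"
    and prod: "\<And>s t. s \<in> S \<Longrightarrow> t \<in> S \<Longrightarrow> s \<cdot> t \<in> P"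
  shows "x \<cdot> y \<in> P"
proof -
  obtain s v where s: "s \<in> span S" "v \<in> lcs k" "x = s + v"
    using mem_span_Un_subspace[OF subspace_lcs] span by blast
  obtain t w where t: "t \<in> span S" "w \<in> lcs k" "y = t + w"
    using mem_span_Un_subspace[OF subspace_lcs] span by blast
  have *: "a \<cdot> t \<in> P" if "a \<in> S" for a
    using t(1) by (induction rule: span_induct_alt)
      (auto simp: mult_add_right mult_scale_right prod that P(1) subspace_add subspace_scale subspace_0)
  have "s \<cdot> t \<in> P"
    using s(1) by (induction rule: span_induct_alt)
      (auto simp: mult_add_left mult_scale_left * P(1) subspace_add subspace_scale subspace_0)
  moreover have "s \<cdot> w \<in> P" "v \<cdot> y \<in> P"
    using s t P(2) mult_mem_lcs_left mult_mem_lcs_right by blast+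
  moreover have "x \<cdot> y = s \<cdot> t + s \<cdot> w + v \<cdot> y"
    using s t by (simp add: mult_add_left mult_add_right)
  ultimately show ?thesis by (simp add: P(1) subspace_add)
qed

text \<open>The new set is \<open>X\<close> with one product per two-element subset of
  \<open>S\<close>. Every product lies in the span of this set and \<open>lcs (Suc k)\<close>, and
  the count matches the recursion of \<open>Omega\<close>.\<close>

lemma span_Un_lcs_Suc:
  assumes gen: "span (X \<union> lcs 1) = UNIV" "finite X" "card X \<le> 2"
    and S: "finite S" "span (S \<union> lcs k) = UNIV"
  shows "\<exists>S'. finite S' \<and> card S' \<le> 2 + (card S choose 2) \<and> span (S' \<union> lcs (Suc k)) = UNIV"
proof -
  let ?pairs = "{P. P \<subseteq> S \<and> card P = 2}"
  \<comment> \<open>An unordered pair determines its product only up to sign; \<open>f\<close> picks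
    one of the two, which makes no difference to the span.\<close>
  define f where "f P = (SOME z. \<exists>s t. P = {s, t} \<and> z = s \<cdot> t)" for P
  define S' where "S' = X \<union> f ` ?pairs"
  let ?P = "span (S' \<union> lcs (Suc k))"
  have fin: "finite ?pairs" using S(1) by simp
  have "card S' \<le> card X + card (f ` ?pairs)" unfolding S'_def by (rule card_Un_le)
  also have "\<dots> \<le> 2 + (card S choose 2)"
    using gen(3) card_image_le[OF fin, of f] n_subsets[OF S(1), of 2] by simp
  finally have card: "card S' \<le> 2 + (card S choose 2)" .
  have prod: "s \<cdot> t \<in> ?P" if "s \<in> S" "t \<in> S" for s t
  proof (cases "s = t")
    case True
    then show ?thesis by (simp add: mult_alternating span_zero)
  next
    case False
    then have *: "{s, t} \<in> ?pairs" using that by auto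
    have "\<exists>s' t'. {s, t} = {s', t'} \<and> f {s, t} = s' \<cdot> t'"
      unfolding f_def by (rule someI[of _ "s \<cdot> t"]) blast
    then have "f {s, t} = s \<cdot> t \<or> f {s, t} = - (s \<cdot> t)"
      using mult_skew[of t s] by (auto simp: doubleton_eq_iff)
    moreover have "f {s, t} \<in> ?P" using * by (intro span_base) (auto simp: S'_def)
    ultimately show ?thesis using span_neg by (metis minus_minus)
  qed
  have "x \<cdot> y \<in> ?P" for x y
    by (rule mult_mem_span_products[OF S(2) _ _ prod]) (auto intro: span_base)
  then have "lcs 1 \<subseteq> ?P"
    by (simp add: set_mult_subset)
  then have "span (X \<union> lcs 1) \<subseteq> ?P"
    by (intro span_minimal) (auto simp: S'_def intro: span_base)
  then show ?thesis using card gen fin by (intro exI[of _ S']) (auto simp: S'_def)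
qed

lemma ex_span_Un_lcs_card_le_Omega:
  assumes gen: "span (X \<union> lcs 1) = UNIV" "finite X" "card X \<le> 2"
  shows "\<exists>S. finite S \<and> card S \<le> Omega k \<and> span (S \<union> lcs k) = UNIV"
proof (induction k)
  case 0
  show ?case by (intro exI[of _ "{}"]) simp
next
  case (Suc k)
  then obtain S where S: "finite S" "card S \<le> Omega k" "span (S \<union> lcs k) = UNIV" by blast
  obtain S' where "finite S'" "card S' \<le> 2 + (card S choose 2)" "span (S' \<union> lcs (Suc k)) = UNIV"
    using span_Un_lcs_Suc[OF gen S(1,3)] by blast
  moreover have "card S choose 2 \<le> Omega k choose 2"
    using S(2) by (rule binomial_right_mono)
  ultimately show ?case by (intro exI[of _ S']) auto
qed

lemma dim_le_Omega:
  assumes gen: "span (X \<union> lcs 1) = UNIV" "finite X" "card X \<le> 2"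
    and "lcs (i + j) = {0}"
  shows "dim (UNIV :: 'v set) \<le> Omega i + Omega j"
proof -
  obtain S where S: "finite S" "card S \<le> Omega i" "span (S \<union> lcs i) = UNIV"
    using ex_span_Un_lcs_card_le_Omega[OF gen] by blast
  obtain T where T: "finite T" "card T \<le> Omega j" "span (T \<union> lcs j) = UNIV"
    using ex_span_Un_lcs_card_le_Omega[OF gen] by blast
  have "dim (UNIV :: 'v set) \<le> card S + card T"
    by (rule dim_UNIV_le_card_add_card[OF S(1) T(1) S(3) T(3) subspace_lcs])
      (rule form_lcs_lcs[OF assms(4) _ _ order_refl])
  then show ?thesis using S(2) T(2) by simp
qed

section \<open>Dimensions 4 and 6\<close>

text \<open>Once two consecutive terms agree, the series is constant from there on, yet it ends at
  zero.\<close>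

lemma lcs_eq_0_if_stable:
  assumes "lcs k = {0}" "lcs i \<subseteq> lcs (Suc i)"
  shows "lcs i = {0}"
proof -
  have "lcs i \<subseteq> lcs (i + j)" for j
  proof (induction j)
    case (Suc j)
    then have "set_mult (lcs i) UNIV \<subseteq> set_mult (lcs (i + j)) UNIV" by (intro set_mult_mono) simp_all
    then show ?case using assms(2) by simp
  qed simp
  then have "lcs i \<subseteq> lcs (i + k)" .
  also have "\<dots> \<subseteq> {0}" using lcs_antimono[of k "i + k"] assms(1) by simp
  finally show ?thesis using subspace_0[OF subspace_lcs] by blast
qed

lemma form_mult_same_left [simp]: "form (x \<cdot> y) x = 0"
  using form_mult_cyclic[of x x y] by (simp add: mult_alternating)

lemma form_mult_same_right [simp]: "form (x \<cdot> y) y = 0"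
  using form_mult_cyclic[of x y y] by (simp add: mult_alternating)

lemma form_neg_left: "form (- x) y = - form x y"
  using form_diff_left[of 0 x y] by simp

lemma form_mult_perms:
  "form (y \<cdot> z) x = form (x \<cdot> y) z"
  "form (z \<cdot> x) y = form (x \<cdot> y) z"
  "form (y \<cdot> x) z = - form (x \<cdot> y) z"
  "form (z \<cdot> y) x = - form (x \<cdot> y) z"
  "form (x \<cdot> z) y = - form (x \<cdot> y) z"
proof -
  have cyc: "form (y \<cdot> z) x = form (x \<cdot> y) z" for x y z by (rule form_mult_cyclic[symmetric])
  have skew: "form (y \<cdot> x) z = - form (x \<cdot> y) z" for x y z
    by (subst mult_skew) (rule form_neg_left)
  show "form (y \<cdot> z) x = form (x \<cdot> y) z" by (rule cyc)
  then show "form (z \<cdot> y) x = - form (x \<cdot> y) z" using skew[where x = y and y = z and z = x] by simp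
  show "form (z \<cdot> x) y = form (x \<cdot> y) z" using cyc by metis
  then show "form (x \<cdot> z) y = - form (x \<cdot> y) z" using skew[where x = z and y = x and z = y] by simp
  show "form (y \<cdot> x) z = - form (x \<cdot> y) z" by (rule skew)
qed

section \<open>The centre\<close>

definition centre :: "'v set" where
  "centre = {z. \<forall>y. z \<cdot> y = 0}"

lemma mult_centre_left: "z \<in> centre \<Longrightarrow> z \<cdot> y = 0"
  by (simp add: centre_def)

lemma mult_centre_right: "z \<in> centre \<Longrightarrow> y \<cdot> z = 0"
  by (subst mult_skew) (simp add: mult_centre_left)

lemma subspace_centre: "subspace centre"
  by (auto simp: subspace_def centre_def mult_add_left mult_scale_left)

text \<open>By the cyclic law \<open>form (z \<cdot> x) y\<close> is
  \<open>form (x \<cdot> y) z\<close>, so it vanishes for all \<open>y\<close>, and nondegeneracy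
  kills \<open>z \<cdot> x\<close>.\<close>

lemma centreI:
  assumes "\<And>x y. form z (x \<cdot> y) = 0"
  shows "z \<in> centre"
proof -
  have "form (z \<cdot> x) y = 0" for x y
    using assms[of x y] form_mult_cyclic[of z x y] form_eq_zero_commute[of z "x \<cdot> y"] by simp
  then show ?thesis unfolding centre_def using form_nondegenerate by blast
qed

text \<open>The annihilator of \<open>lcs 1\<close> lies in the centre, and it is cut out by
  \<open>dim (lcs 1)\<close> linear conditions.\<close>

lemma dim_UNIV_le_dim_lcs_1_centre: "dim (UNIV :: 'v set) \<le> dim (lcs 1) + dim centre"
proof -
  obtain T where T: "T \<subseteq> lcs 1" "independent T" "lcs 1 \<subseteq> span T" "card T = dim (lcs 1)"
    by (rule basis_exists)
  have "{x \<in> UNIV. \<forall>t\<in>T. form x t = 0} \<subseteq> centre"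
  proof
    fix z assume "z \<in> {x \<in> UNIV. \<forall>t\<in>T. form x t = 0}"
    moreover have "x \<cdot> y \<in> span T" for x y
      using mult_mem_lcs_left[of x 0 y] T(3) by auto
    ultimately have "form z (x \<cdot> y) = 0" for x y by (intro form_span_eq_zero[of T z "x \<cdot> y"]) auto
    then show "z \<in> centre" by (rule centreI)
  qed
  then have "dim {x \<in> UNIV. \<forall>t\<in>T. form x t = 0} \<le> dim centre" by (rule dim_subset)
  then show ?thesis
    using dim_le_dim_annihilator[OF finiteI_independent[OF T(2)] subspace_UNIV] T(4) by linarith
qed

text \<open>With \<open>z\<close> central all products of the two generators vanish, so
  \<open>lcs 1\<close> is contained in \<open>lcs 2\<close> and is zero by nilpotency; then
  \<open>z\<close> and \<open>w\<close> span.\<close>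

lemma dim_le_2_if_central_generator:
  assumes nil: "lcs k = {0}" and gen: "span ({z, w} \<union> lcs 1) = UNIV" and z: "z \<in> centre"
  shows "dim (UNIV :: 'v set) \<le> 2"
proof -
  have "x \<cdot> y \<in> lcs 2" for x y
  proof (rule mult_mem_span_products[OF gen subspace_lcs])
    show "s \<cdot> t \<in> lcs 2" if "s \<in> {z, w}" "t \<in> {z, w}" for s t
      using that z subspace_0[OF subspace_lcs]
      by (auto simp: mult_alternating mult_centre_left mult_centre_right)
  qed (simp add: numeral_2_eq_2)
  then have "set_mult (lcs 0) UNIV \<subseteq> lcs 2" by (intro set_mult_subset subspace_lcs)
  then have "lcs 1 \<subseteq> lcs (Suc 1)" by (simp add: numeral_2_eq_2)
  then have "lcs 1 = {0}" by (rule lcs_eq_0_if_stable[OF nil])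
  then have "UNIV = span {z, w}" using gen by (simp add: insert_commute)
  then have "dim (UNIV :: 'v set) \<le> card {z, w}" by (intro dim_le_card) auto
  also have "\<dots> \<le> 2" by (simp add: card_insert_if)
  finally show ?thesis .
qed

lemma ex_span_insert_eq_UNIV:
  assumes "dim (UNIV :: 'v set) \<le> dim S + 1"
  shows "\<exists>w. span (insert w S) = UNIV"
proof (cases "span S = UNIV")
  case True
  then show ?thesis by (intro exI[of _ 0]) simp
next
  case False
  then obtain w where "w \<notin> span S" by blast
  then have "dim (insert w S) = dim S + 1" by (simp add: dim_insert)
  then have "dim (insert w S) = dimension"
    using assms dim_subset_UNIV[of "insert w S"] by (simp add: dimension_def)
  then show ?thesis unfolding dim_eq_full by (rule exI)
qed

lemma not_4_le_dim_le_6: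
  assumes nil: "lcs k = {0}" and gen: "span ({a, b} \<union> lcs 1) = UNIV"
    and dim4: "4 \<le> dim (UNIV :: 'v set)" and dim6: "dim (UNIV :: 'v set) \<le> 6"
  shows False
proof -
  define u where "u = a \<cdot> b"
  have u_lcs: "u \<in> lcs 1" using mult_mem_lcs_left[of a 0 b] by (simp add: u_def)
  have no_central_generator: False if "span ({z, w} \<union> lcs 1) = UNIV" "z \<in> centre" for z w
    using dim_le_2_if_central_generator[OF nil that] dim4 by simp
  \<comment> \<open>Otherwise the central vector \<open>0\<close> and one further vector would span
    modulo \<open>lcs 1\<close>.\<close>
  have "\<not> dim (UNIV :: 'v set) \<le> dim (lcs 1) + 1"
  proof
    assume "dim (UNIV :: 'v set) \<le> dim (lcs 1) + 1"
    then obtain w where "span (insert w (lcs 1)) = UNIV" using ex_span_insert_eq_UNIV by blast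
    then have "span ({0, w} \<union> lcs 1) = UNIV" by simp
    then show False using no_central_generator subspace_0[OF subspace_centre] by blast
  qed
  then have dim_centre: "2 \<le> dim centre" using dim_UNIV_le_dim_lcs_1_centre by linarith

  \<comment> \<open>A combination with nonzero coefficient at the generator \<open>d\<close> can
    replace \<open>d\<close>, because its \<open>u\<close> part lies in
    \<open>lcs 1\<close>.\<close>
  have span_gen: "span ({z, c} \<union> lcs 1) = UNIV"
    if "{a, b} = {d, c}" "z = scale \<alpha> d + scale \<beta> c + scale \<gamma> u" "\<alpha> \<noteq> 0" for z c d \<alpha> \<beta> \<gamma>
  proof -
    let ?S = "span ({z, c} \<union> lcs 1)"
    have "scale \<alpha> d = z - scale \<beta> c - scale \<gamma> u" using that(2) by (simp add: algebra_simps)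
    then have "d = scale (1 / \<alpha>) (z - scale \<beta> c - scale \<gamma> u)"
      using that(3) by (metis scale_scale nonzero_eq_divide_eq mult.commute scale_one)
    also have "\<dots> \<in> ?S"
      using u_lcs by (intro span_scale span_diff span_base) auto
    finally have "span ({a, b} \<union> lcs 1) \<subseteq> ?S"
      unfolding that(1) by (intro span_minimal) (auto intro: span_base)
    then show ?thesis using gen by blast
  qed
  \<comment> \<open>If \<open>u\<close> were central, then \<open>lcs 1\<close>, spanned by
    \<open>u\<close> modulo \<open>lcs 2\<close>, would have all its products in
    \<open>lcs 3\<close>; so \<open>lcs 2\<close> would vanish and \<open>a\<close>,
    \<open>b\<close>, \<open>u\<close> would span.\<close>
  have u_noncentral: "u \<notin> centre"
  proof
    assume u: "u \<in> centre"
    have lcs_1: "lcs 1 \<subseteq> span (insert u (lcs 2))"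
    proof -
      have "x \<cdot> y \<in> span (insert u (lcs 2))" for x y
      proof (rule mult_mem_span_products[OF gen subspace_span])
        have "b \<cdot> a = - u" unfolding u_def by (rule mult_skew)
        then show "s \<cdot> t \<in> span (insert u (lcs 2))" if "s \<in> {a, b}" "t \<in> {a, b}" for s t
          using that by (auto simp: mult_alternating u_def[symmetric] span_zero
              intro!: span_neg intro: span_base)
      qed (auto simp: numeral_2_eq_2 intro: span_base)
      then show ?thesis by (simp add: set_mult_subset)
    qed
    have "x \<cdot> y \<in> lcs 3" if x: "x \<in> lcs 1" for x y
    proof -
      have "x \<in> span (insert u (lcs 2))" using x lcs_1 by blast
      then obtain c where "x - scale c u \<in> lcs 2" unfolding span_breakdown_eq span_lcs by blast
      then have "(x - scale c u) \<cdot> y \<in> lcs (Suc 2)" by (rule mult_mem_lcs_left)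
      moreover have "x \<cdot> y = (x - scale c u) \<cdot> y + scale c u \<cdot> y"
        by (simp flip: mult_add_left)
      then have "x \<cdot> y = (x - scale c u) \<cdot> y"
        by (simp add: mult_scale_left mult_centre_left[OF u])
      ultimately show ?thesis by (simp add: numeral_3_eq_3 numeral_2_eq_2)
    qed
    then have "set_mult (lcs 1) UNIV \<subseteq> lcs 3" by (simp add: set_mult_subset subspace_lcs del: lcs.simps)
    then have "lcs 2 \<subseteq> lcs (Suc 2)" by (simp add: numeral_3_eq_3 numeral_2_eq_2)
    then have "lcs 2 = {0}" by (rule lcs_eq_0_if_stable[OF nil])
    then have "lcs 1 \<subseteq> span {u}" using lcs_1 by (simp add: insert_commute)
    then have "{a, b} \<union> lcs 1 \<subseteq> span {a, b, u}"
      using span_mono[of "{u}" "{a, b, u}"] by (auto intro: span_base)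
    then have "UNIV \<subseteq> span {a, b, u}" using gen span_minimal[OF _ subspace_span] by metis
    then have "dim (UNIV :: 'v set) \<le> card {a, b, u}" by (intro dim_le_card) auto
    also have "\<dots> \<le> 3" by (simp add: card_insert_if)
    finally show False using dim4 by simp
  qed
  \<comment> \<open>A nonzero coefficient at \<open>a\<close> or \<open>b\<close> would give a
    central generator; without one, a nonzero coefficient at \<open>u\<close> would make
    \<open>u\<close> central.\<close>
  have independent_mod_centre: "\<alpha> = 0 \<and> \<beta> = 0 \<and> \<gamma> = 0"
    if z: "scale \<alpha> a + scale \<beta> b + scale \<gamma> u \<in> centre" for \<alpha> \<beta> \<gamma>
  proof -
    have \<alpha>: "\<alpha> = 0"
      using no_central_generator[OF span_gen[of a b _ \<alpha> \<beta> \<gamma>] z] by blast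
    have "scale \<alpha> a + scale \<beta> b + scale \<gamma> u = scale \<beta> b + scale \<alpha> a + scale \<gamma> u" by simp
    then have \<beta>: "\<beta> = 0"
      using no_central_generator[OF span_gen[of b a _ \<beta> \<alpha> \<gamma>] z] by blast
    have "\<gamma> = 0"
    proof (rule ccontr)
      assume "\<gamma> \<noteq> 0"
      have "scale \<gamma> u \<in> centre" using z \<alpha> \<beta> by simp
      then have "scale (1 / \<gamma>) (scale \<gamma> u) \<in> centre" by (rule subspace_scale[OF subspace_centre])
      then show False using \<open>\<gamma> \<noteq> 0\<close> u_noncentral by simp
    qed
    then show ?thesis using \<alpha> \<beta> by simp
  qed

  have span_centre: "span centre = centre" by (simp add: span_eq_iff subspace_centre)
  have "b \<notin> span (insert u centre)"
  proof
    assume "b \<in> span (insert u centre)"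
    then obtain c where "b - scale c u \<in> centre" by (auto simp: span_breakdown_eq span_centre)
    then show False using independent_mod_centre[of 0 1 "- c"] by simp
  qed
  moreover have "a \<notin> span (insert b (insert u centre))"
  proof
    assume "a \<in> span (insert b (insert u centre))"
    then obtain c d where "a - scale d b - scale c u \<in> centre"
      by (auto simp: span_breakdown_eq span_centre)
    then show False using independent_mod_centre[of 1 "- d" "- c"] by simp
  qed
  ultimately have "dim (insert a (insert b (insert u centre))) = dim centre + 3"
    using u_noncentral by (simp add: dim_insert span_centre)
  \<comment> \<open>At least 2 + 3 of at most 6 dimensions are accounted for, so one more vector
    \<open>w\<close> suffices.\<close>
  then have "dim (UNIV :: 'v set) \<le> dim (insert a (insert b (insert u centre))) + 1"
    using dim_centre dim6 by linarith
  then obtain w where w: "span (insert w (insert a (insert b (insert u centre)))) = UNIV"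
    using ex_span_insert_eq_UNIV by blast
  let ?S = "insert w (insert a (insert b (insert u centre)))"

  txt \<open>Modulo the centre, the trilinear form \<open>form (x \<cdot> y) z\<close> lives on the span of \<open>a, b, u, w\<close>.
    An alternating trilinear form in dimension 4 is the contraction of a volume form with a
    vector, and this vector \<open>v\<close> lies in its radical.\<close>

  define p q r where "p = form (a \<cdot> b) w" and "q = form (a \<cdot> u) w" and "r = form (b \<cdot> u) w"
  define v where "v = scale r a + scale (- q) b + scale p u"
  \<comment> \<open>Because of this value the contraction vector \<open>v\<close> has no
    \<open>w\<close> component.\<close>
  have abu: "form (a \<cdot> b) u = 0" by (simp add: u_def form_alternating)
  note perms = form_mult_perms[where x = a and y = b and z = u] form_mult_perms[where x = a and y = b and z = w] form_mult_perms[where x = a and y = u and z = w]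
    form_mult_perms[where x = b and y = u and z = w]
  have v_products: "form v (x \<cdot> y) = 0" if "x \<in> ?S" "y \<in> ?S" for x y
  proof -
    have "form (x \<cdot> y) v = 0"
    proof (cases "x \<in> centre \<or> y \<in> centre")
      case True
      then show ?thesis by (auto simp: mult_centre_left mult_centre_right)
    next
      case False
      then have "x \<in> {a, b, u, w}" "y \<in> {a, b, u, w}" using that by auto
      then show ?thesis
        unfolding v_def form_add_right form_scale_right
        by (auto simp: mult_alternating perms abu p_def[symmetric] q_def[symmetric] r_def[symmetric])
    qed
    then show ?thesis by (simp add: form_eq_zero_commute)
  qed
  have "form v (x \<cdot> y) = 0" for x y
  proof -
    have "x \<cdot> y \<in> span {s \<cdot> t | s t. s \<in> ?S \<and> t \<in> ?S}"
      by (rule mult_mem_span_products[of ?S k])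
        (use w nil subspace_0[OF subspace_span] lcs_Suc_subset[of k] in \<open>auto simp: span_zero intro: span_base\<close>)
    then show ?thesis using v_products by (intro form_span_eq_zero[of _ v "x \<cdot> y"]) auto
  qed
  then have "v \<in> centre" by (rule centreI)
  then have p: "p = 0" unfolding v_def by (blast dest: independent_mod_centre)
  \<comment> \<open>\<open>u\<close> is orthogonal to \<open>a\<close>, \<open>b\<close> and itself
    by alternation, to \<open>w\<close> by \<open>p = 0\<close>, and to the centre by the cyclic
    law.\<close>
  have "form u y = 0" for y
  proof (rule form_span_eq_zero[of ?S])
    show "form u t = 0" if "t \<in> ?S" for t
    proof (cases "t \<in> centre")
      case True
      then show ?thesis
        unfolding u_def form_mult_cyclic[of a b] by (simp add: mult_centre_right)
    next
      case False
      then show ?thesis using that p by (auto simp: u_def p_def form_alternating)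
    qed
  qed (use w in simp)
  then have "u = 0" by (rule form_nondegenerate)
  then show False using u_noncentral subspace_0[OF subspace_centre] by simp
qed

section \<open>The rank\<close>

lemma algebra_rank_witness:
  obtains X where "finite X" "card X = algebra_rank" "is_subalgebra hull X = UNIV"
proof -
  obtain B where B: "finite B" "span B = UNIV" using finite_dim by blast
  have "span B \<subseteq> A" if "is_subalgebra A" "B \<subseteq> A" for A
    using that by (intro span_minimal) (auto simp: is_subalgebra_def)
  then have "is_subalgebra hull B = UNIV" using B(2) by (auto simp: hull_def)
  then have "\<exists>r X. finite X \<and> card X = r \<and> is_subalgebra hull X = UNIV" using B(1) by blast
  then have "\<exists>X. finite X \<and> card X = algebra_rank \<and> is_subalgebra hull X = UNIV"
    unfolding algebra_rank_def by (rule LeastI_ex)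
  then show ?thesis using that by blast
qed

text \<open>Since \<open>y \<cdot> y = 0\<close>, a single element generates only the line it spans,
  which is too small in dimension at least 2.\<close>

lemma algebra_rank_eq_2:
  assumes "is_subalgebra hull {a, b} = UNIV" "2 \<le> dim (UNIV :: 'v set)"
  shows "algebra_rank = 2"
proof -
  obtain X where X: "finite X" "card X = algebra_rank" "is_subalgebra hull X = UNIV"
    by (rule algebra_rank_witness)
  have ge: "2 \<le> card Y" if Y: "finite Y" "is_subalgebra hull Y = UNIV" for Y
  proof (rule ccontr)
    assume "\<not> 2 \<le> card Y"
    then have "card Y \<le> Suc 0" by simp
    then have eq: "\<forall>x\<in>Y. \<forall>y\<in>Y. x = y" using Y(1) by (simp only: card_le_Suc0_iff_eq)
    obtain y where "Y \<subseteq> {y}"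
    proof (cases "Y = {}")
      case False
      then show ?thesis using that eq by blast
    qed (use that in blast)
    moreover have "is_subalgebra (span {y})"
      unfolding is_subalgebra_def
      by (intro conjI subspace_span)
        (auto simp: span_singleton mult_scale_left mult_scale_right mult_alternating)
    ultimately have "is_subalgebra hull Y \<subseteq> span {y}"
      by (intro hull_minimal) (auto intro: span_base)
    then have "UNIV \<subseteq> span {y}" using Y(2) by simp
    then have "dim (UNIV :: 'v set) \<le> card {y}" by (intro dim_le_card) auto
    then show False using assms(2) by simp
  qed
  have "card {a, b} = 2" using ge[of "{a, b}"] assms(1) by (simp add: card_insert_if split: if_splits)
  then have "algebra_rank \<le> 2"
    unfolding algebra_rank_def using assms(1) by (intro Least_le exI[of _ "{a, b}"]) simp
  then show ?thesis using ge[of X] X by simp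
qed

end

section \<open>Algebras from alternating trilinear forms\<close>

text \<open>A basis \<open>e\<close> with its dual coordinate functions \<open>c\<close>, kept as
  parameters so that forms and products can be written by index.\<close>

locale coordinatized_space = vector_space scale
  for scale :: "'a::field \<Rightarrow> 'v::ab_group_add \<Rightarrow> 'v" +
  fixes n :: nat and e :: "nat \<Rightarrow> 'v" and c :: "nat \<Rightarrow> 'v \<Rightarrow> 'a"
  assumes coord_add: "c i (x + y) = c i x + c i y"
    and coord_scale: "c i (scale r x) = r * c i x"
    and coord_e: "i < 2 * n \<Longrightarrow> j < 2 * n \<Longrightarrow> c i (e j) = (if i = j then 1 else 0)"
    and coord_expansion: "(\<Sum>i<2 * n. scale (c i x) (e i)) = x"
begin

lemma coord_zero [simp]: "c i 0 = 0"
  using coord_scale[of i 0 0] by simp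

lemma coord_diff: "c i (x - y) = c i x - c i y"
  using coord_add[of i "x - y" y] by simp

lemma coord_sum: "c i (sum f A) = (\<Sum>a\<in>A. c i (f a))"
  by (induction A rule: infinite_finite_induct) (simp_all add: coord_add)

lemma coord_eqI:
  assumes "\<And>i. i < 2 * n \<Longrightarrow> c i x = c i y"
  shows "x = y"
proof -
  have "(\<Sum>i<2 * n. scale (c i x) (e i)) = (\<Sum>i<2 * n. scale (c i y) (e i))"
    using assms by (intro sum.cong) auto
  then show ?thesis by (simp only: coord_expansion)
qed

end

lemma (in vector_space) ex_coordinatized_space:
  assumes "finite B" "span B = UNIV" "dim UNIV = 2 * n"
  shows "\<exists>e c. coordinatized_space scale n e c"
proof -
  obtain C where C: "C \<subseteq> B" "independent C" "B \<subseteq> span C"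
    using maximal_independent_subset by blast
  have span: "span C = UNIV" using assms(2) span_minimal[OF C(3) subspace_span] by blast
  have fin: "finite C" using C(1) assms(1) by (rule finite_subset)
  have "card C = 2 * n" using dim_unique[of C UNIV] C(2) span assms(3) by simp
  then obtain e where e: "bij_betw e {..<2 * n} C"
    using ex_bij_betw_nat_finite[OF fin] by (auto simp: atLeast0LessThan)
  let ?c = "\<lambda>i x. representation C x (e i)"
  have "coordinatized_space scale n e ?c"
  proof unfold_locales
    show "?c i (x + y) = ?c i x + ?c i y" for i x y
      by (simp add: representation_add C(2) span)
    show "?c i (scale r x) = r * ?c i x" for i r x
      by (simp add: representation_scale C(2) span)
    show "?c i (e j) = (if i = j then 1 else 0)" if "i < 2 * n" "j < 2 * n" for i j
    proof -
      have "e j \<in> C" using bij_betwE[OF e] that(2) by simp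
      moreover have "e i = e j \<longleftrightarrow> i = j"
        using that by (intro inj_on_eq_iff[OF bij_betw_imp_inj_on[OF e]]) auto
      ultimately show ?thesis by (simp add: representation_basis C(2))
    qed
    show "(\<Sum>i<2 * n. scale (?c i x) (e i)) = x" for x
    proof -
      have "(\<Sum>i<2 * n. scale (?c i x) (e i)) = (\<Sum>b\<in>C. scale (representation C x b) b)"
        by (rule sum.reindex_bij_betw[OF e])
      also have "\<dots> = x" using C(2) fin span by (intro sum_representation_eq) auto
      finally show ?thesis .
    qed
  qed
  then show ?thesis by blast
qed

text \<open>The hyperbolic form pairs \<open>e i\<close> with \<open>e (2 * n - 1 - i)\<close>, and \<open>product x y\<close> is the vector
  that represents \<open>\<phi> x y\<close> with respect to it.\<close>

locale trilinear_coordinatized_space = coordinatized_space scale n e c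
  for scale :: "'a::field \<Rightarrow> 'v::ab_group_add \<Rightarrow> 'v" and n e c +
  fixes \<phi> :: "'v \<Rightarrow> 'v \<Rightarrow> 'v \<Rightarrow> 'a"
  assumes tri_add: "\<phi> (x + x') y z = \<phi> x y z + \<phi> x' y z"
    and tri_scale: "\<phi> (scale r x) y z = r * \<phi> x y z"
    and tri_cyclic: "\<phi> x y z = \<phi> y z x"
    and tri_alternating: "\<phi> x x z = 0"
begin

definition pairing :: "'v \<Rightarrow> 'v \<Rightarrow> 'a" where
  "pairing x y = (\<Sum>i<n. c i x * c (2 * n - 1 - i) y - c (2 * n - 1 - i) x * c i y)"

definition product :: "'v \<Rightarrow> 'v \<Rightarrow> 'v" where
  "product x y = (\<Sum>i<n. scale (\<phi> x y (e (2 * n - 1 - i))) (e i)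
     - scale (\<phi> x y (e i)) (e (2 * n - 1 - i)))"

lemma coord_product:
  assumes "l < 2 * n"
  shows "c l (product x y) = (if l < n then 1 else - 1) * \<phi> x y (e (2 * n - 1 - l))"
proof -
  have "c l (product x y) = (\<Sum>i<n. (if i = l then \<phi> x y (e (2 * n - 1 - i)) else 0)
      - (if i = 2 * n - 1 - l then \<phi> x y (e i) else 0))"
    unfolding product_def coord_sum coord_diff coord_scale
    using assms by (intro sum.cong) (auto simp: coord_e)
  also have "\<dots> = (if l < n then 1 else - 1) * \<phi> x y (e (2 * n - 1 - l))"
    using assms by (auto simp: sum_subtractf)
  finally show ?thesis .
qed

lemma tri_add_right: "\<phi> x y (z + z') = \<phi> x y z + \<phi> x y z'"
  and tri_scale_right: "\<phi> x y (scale r z) = r * \<phi> x y z"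
  using tri_cyclic tri_add tri_scale by metis+

lemma tri_add_mid: "\<phi> x (y + y') z = \<phi> x y z + \<phi> x y' z"
  and tri_scale_mid: "\<phi> x (scale r y) z = r * \<phi> x y z"
  using tri_cyclic tri_add tri_scale by metis+

lemma tri_zero_right [simp]: "\<phi> x y 0 = 0"
  using tri_scale_right[of x y 0 0] by simp

lemma tri_sum_right: "\<phi> x y (sum f A) = (\<Sum>a\<in>A. \<phi> x y (f a))"
  by (induction A rule: infinite_finite_induct) (simp_all add: tri_add_right)

text \<open>The signs in \<open>product\<close> cancel those in \<open>pairing\<close>, which leaves
  the expansion of \<open>z\<close> in the basis. The cyclic law for the product is thereby that of
  \<open>\<phi>\<close>.\<close>

lemma pairing_product: "pairing (product x y) z = \<phi> x y z"
proof -
  let ?f = "\<lambda>i. c i z * \<phi> x y (e i)"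
  have "pairing (product x y) z = (\<Sum>i<n. ?f (2 * n - 1 - i) + ?f i)"
    unfolding pairing_def by (intro sum.cong) (auto simp: coord_product)
  also have "\<dots> = (\<Sum>i<n. ?f (2 * n - 1 - i)) + (\<Sum>i<n. ?f i)"
    by (rule sum.distrib)
  also have "(\<Sum>i<n. ?f (2 * n - 1 - i)) = (\<Sum>i\<in>{n..<2 * n}. ?f i)"
    by (rule sum.reindex_bij_witness[of _ "\<lambda>i. 2 * n - 1 - i" "\<lambda>i. 2 * n - 1 - i"]) auto
  also have "(\<Sum>i\<in>{n..<2 * n}. ?f i) + (\<Sum>i<n. ?f i) = (\<Sum>i<2 * n. ?f i)"
    by (subst sum.union_disjoint[symmetric]) (auto intro!: sum.cong)
  also have "\<dots> = \<phi> x y (\<Sum>i<2 * n. scale (c i z) (e i))"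
    by (simp only: tri_sum_right tri_scale_right)
  finally show ?thesis by (simp only: coord_expansion)
qed

lemma pairing_e:
  assumes "l < 2 * n"
  shows "pairing x (e l) = (if n \<le> l then 1 else - 1) * c (2 * n - 1 - l) x"
proof -
  have "pairing x (e l) = (\<Sum>i<n. (if i = 2 * n - 1 - l then c i x else 0)
      - (if i = l then c (2 * n - 1 - i) x else 0))"
    unfolding pairing_def using assms by (intro sum.cong) (auto simp: coord_e)
  also have "\<dots> = (if n \<le> l then 1 else - 1) * c (2 * n - 1 - l) x"
    using assms by (auto simp: sum_subtractf)
  finally show ?thesis .
qed

lemma span_e: "span (e ` {..<2 * n}) = UNIV"
proof -
  have "(\<Sum>i<2 * n. scale (c i x) (e i)) \<in> span (e ` {..<2 * n})" for x
    by (intro span_sum span_scale span_base) auto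
  then show ?thesis unfolding coord_expansion by blast
qed

lemma product_add_left: "product (x + x') y = product x y + product x' y"
  and product_scale_left: "product (scale r x) y = scale r (product x y)"
  and product_add_right: "product x (y + y') = product x y + product x y'"
  and product_scale_right: "product x (scale r y) = scale r (product x y)"
  and product_alternating: "product x x = 0"
  by (auto intro!: coord_eqI simp: coord_product coord_add coord_scale tri_add tri_scale
      tri_add_mid tri_scale_mid tri_alternating)

lemma symplectic_alternating_algebra_product:
  "symplectic_alternating_algebra scale pairing product"
proof -
  have vs: "vector_space scale" by (rule vector_space_axioms)
  have vs': "vector_space ((*) :: 'a \<Rightarrow> 'a \<Rightarrow> 'a)" by unfold_locales (auto simp: algebra_simps)
  show ?thesis
  proof (intro symplectic_alternating_algebra.intro symplectic_alternating_algebra_axioms.intro vs)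
    show "\<exists>B. finite B \<and> span B = UNIV" using span_e by blast
    show "Vector_Spaces.linear scale (*) (\<lambda>y. pairing x y)" for x
      using vs vs' unfolding Vector_Spaces.linear_iff
      by (auto simp: pairing_def coord_add coord_scale sum_distrib_left sum.distrib[symmetric]
          algebra_simps intro!: sum.cong)
    show "Vector_Spaces.linear scale (*) (\<lambda>x. pairing x y)" for y
      using vs vs' unfolding Vector_Spaces.linear_iff
      by (auto simp: pairing_def coord_add coord_scale sum_distrib_left sum.distrib[symmetric]
          algebra_simps intro!: sum.cong)
    show "pairing x x = 0" for x by (simp add: pairing_def)
    show "x = 0" if "\<And>y. pairing x y = 0" for x
    proof (rule coord_eqI)
      fix i assume i: "i < 2 * n"
      have "pairing x (e (2 * n - 1 - i)) = 0" by (rule that)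
      then show "c i x = c i 0" using i by (auto simp: pairing_e split: if_splits)
    qed
    show "Vector_Spaces.linear scale scale (\<lambda>y. product x y)" for x
      using vs by (simp add: Vector_Spaces.linear_iff product_add_right product_scale_right)
    show "Vector_Spaces.linear scale scale (\<lambda>x. product x y)" for y
      using vs by (simp add: Vector_Spaces.linear_iff product_add_left product_scale_left)
    show "product x x = 0" for x by (rule product_alternating)
    show "pairing (product x y) z = pairing (product y z) x" for x y z
      unfolding pairing_product by (rule tri_cyclic)
  qed
qed

text \<open>Stage \<open>s\<close> is spanned by the \<open>e i\<close> with
  \<open>d i + s > k\<close>. Coordinate \<open>i\<close> of a product is, up to sign, the value of
  \<open>\<phi>\<close> at the dual vector, whose weight is \<open>k + 1 - d i\<close>; so
  \<open>tri\<close> says that multiplication raises the weight.\<close>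

lemma nilpotency_chain_product:
  assumes dual: "\<And>i. i < 2 * n \<Longrightarrow> 1 \<le> d i \<and> d i + d (2 * n - 1 - i) = k + 1"
    and tri: "\<And>x y l. l < 2 * n \<Longrightarrow> (\<And>i. i < 2 * n \<Longrightarrow> d i + d l \<le> k \<Longrightarrow> c i x = 0) \<Longrightarrow> \<phi> x y (e l) = 0"
  shows "symplectic_alternating_algebra.nilpotency_chain scale product k
    (\<lambda>s. {x. \<forall>i<2 * n. d i + s \<le> k \<longrightarrow> c i x = 0})"
proof -
  interpret symplectic_alternating_algebra scale pairing product
    by (rule symplectic_alternating_algebra_product)
  let ?I = "\<lambda>s. {x. \<forall>i<2 * n. d i + s \<le> k \<longrightarrow> c i x = 0}"
  have le: "d i \<le> k" if "i < 2 * n" for i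
    using dual[OF that] dual[of "2 * n - 1 - i"] that by simp
  have sub: "subspace (?I s)" for s
    by (auto simp: subspace_def coord_add coord_scale)
  have step: "product x y \<in> ?I (s - 1)" if x: "x \<in> ?I s" "1 \<le> s" for x y s
  proof -
    have "c i (product x y) = 0" if i: "i < 2 * n" "d i + (s - 1) \<le> k" for i
    proof -
      have "s \<le> d (2 * n - 1 - i)" using dual[OF i(1)] i(2) x(2) by linarith
      then have "\<phi> x y (e (2 * n - 1 - i)) = 0" using x i(1) by (intro tri) auto
      then show ?thesis by (simp add: coord_product i(1))
    qed
    then show ?thesis by blast
  qed
  have mono: "?I (s - 1) \<subseteq> ?I s" for s by auto
  have I_0: "?I 0 = {0}" using le by (auto intro: coord_eqI)
  have I_k: "?I k = UNIV"
  proof -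
    have "\<not> d i + k \<le> k" if "i < 2 * n" for i using dual[OF that] by simp
    then show ?thesis by blast
  qed
  have ideal: "is_ideal (?I s)" for s
  proof -
    \<comment> \<open>Stage 0 is treated apart: \<open>s - 1\<close> is \<open>s\<close> there, and
      \<open>step\<close> needs \<open>1 \<le> s\<close>.\<close>
    have left: "product x y \<in> ?I s" if "x \<in> ?I s" for x y
    proof (cases "s = 0")
      case True
      then have "x = 0" using that I_0 by auto
      then show ?thesis by simp
    next
      case False
      then show ?thesis using step[OF that, of y] mono[of s] by auto
    qed
    have right: "product y x \<in> ?I s" if "x \<in> ?I s" for x y
      by (subst mult_skew) (rule subspace_neg[OF sub left[OF that]])
    show ?thesis
      unfolding is_ideal_def by (intro conjI sub set_mult_subset[OF sub]) (erule left, erule right)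
  qed
  have "set_mult (?I s) UNIV \<subseteq> ?I (s - 1)" if "1 \<le> s" for s
    by (rule set_mult_subset[OF sub]) (rule step[OF _ that])
  then have descent: "\<forall>s\<in>{1..k}. set_mult (?I s) UNIV \<subseteq> ?I (s - 1)" by (meson atLeastAtMost_iff)
  show ?thesis
    unfolding nilpotency_chain_def
    by (intro conjI I_0 I_k descent) (intro allI ballI impI ideal mono)+
qed

text \<open>Pairing with \<open>e l\<close> is, up to sign, the coordinate
  \<open>2 * n - 1 - l\<close>, so \<open>gen\<close> makes \<open>e l\<close> a product of two
  earlier basis vectors up to sign, and induction on \<open>l\<close> reaches the whole
  basis.\<close>

lemma hull_e0_e1:
  assumes gen: "\<And>l. 2 \<le> l \<Longrightarrow> l < 2 * n \<Longrightarrow>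
    \<exists>i<l. \<exists>j<l. \<forall>z. \<phi> (e i) (e j) z = c (2 * n - 1 - l) z"
  shows "symplectic_alternating_algebra.is_subalgebra scale product hull {e 0, e 1} = UNIV"
proof -
  interpret symplectic_alternating_algebra scale pairing product
    by (rule symplectic_alternating_algebra_product)
  have "UNIV \<subseteq> A" if A: "is_subalgebra A" "{e 0, e 1} \<subseteq> A" for A
  proof -
    have sub: "subspace A" and prod: "\<And>x y. x \<in> A \<Longrightarrow> y \<in> A \<Longrightarrow> product x y \<in> A"
      using A(1) by (auto simp: is_subalgebra_def)
    have "e l \<in> A" if "l < 2 * n" for l
      using that
    proof (induction l rule: less_induct)
      case (less l)
      show ?case
      proof (cases "l < 2")
        case True
        then have "l = 0 \<or> l = 1" by auto
        then show ?thesis using A(2) by auto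
      next
        case False
        then obtain i j where ij: "i < l" "j < l"
          "\<And>z. \<phi> (e i) (e j) z = c (2 * n - 1 - l) z" using gen[of l] less.prems by auto
        define \<epsilon> :: 'a where "\<epsilon> = (if l < n then 1 else - 1)"
        have "product (e i) (e j) = scale \<epsilon> (e l)"
        proof (rule coord_eqI)
          fix m assume m: "m < 2 * n"
          have "2 * n - 1 - l = 2 * n - 1 - m \<longleftrightarrow> m = l" using m less.prems by auto
          then show "c m (product (e i) (e j)) = c m (scale \<epsilon> (e l))"
            using m less.prems by (simp add: coord_product ij(3) coord_scale coord_e \<epsilon>_def)
        qed
        then have "scale \<epsilon> (product (e i) (e j)) = e l" by (simp add: \<epsilon>_def)
        moreover have "product (e i) (e j) \<in> A" using ij less by (intro prod) auto
        ultimately show ?thesis using subspace_scale[OF sub] by metis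
      qed
    qed
    then have "span (e ` {..<2 * n}) \<subseteq> A" using sub by (intro span_minimal) auto
    then show ?thesis by (simp add: span_e)
  qed
  then show ?thesis by (auto simp: hull_def)
qed

end

section \<open>Examples from weighted triple systems\<close>

definition det3 :: "('v \<Rightarrow> 'a::comm_ring_1) \<Rightarrow> ('v \<Rightarrow> 'a) \<Rightarrow> ('v \<Rightarrow> 'a) \<Rightarrow> 'v \<Rightarrow> 'v \<Rightarrow> 'v \<Rightarrow> 'a" where
  "det3 f g h x y z = f x * (g y * h z - h y * g z) - g x * (f y * h z - h y * f z)
     + h x * (f y * g z - g y * f z)"

text \<open>The basis vector \<open>e i\<close> gets weight \<open>d ! i\<close>, and each triple \<open>(i, j, k)\<close> contributes the
  determinant of the coordinates \<open>i, j, k\<close> to the trilinear form. As dual vectors have weights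
  adding up to \<open>cls + 1\<close>, the condition on pairs of weights says that multiplication raises the
  weight, so that the class is at most \<open>cls\<close>. By the conditions on \<open>filter\<close> no two triples share two
  points; so the product of two basis vectors of a triple is, up to sign, the dual of the third,
  and the last condition produces all of them from \<open>e 0\<close> and \<open>e 1\<close>.\<close>

definition weighted_triples :: "nat \<Rightarrow> nat \<Rightarrow> nat list \<Rightarrow> (nat \<times> nat \<times> nat) list \<Rightarrow> bool" where
  "weighted_triples n cls d T \<longleftrightarrow>
     (\<forall>i\<in>set [0..<2 * n]. 1 \<le> d ! i \<and> d ! i + d ! (2 * n - 1 - i) = cls + 1) \<and>
     (\<forall>(i, j, k)\<in>set T. i < j \<and> j < k \<and> k < 2 * n \<and>
        d ! i + d ! j \<le> cls \<and> d ! i + d ! k \<le> cls \<and> d ! j + d ! k \<le> cls \<and>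
        filter (\<lambda>(p, q, r). i \<in> {p, q, r} \<and> j \<in> {p, q, r}) T = [(i, j, k)] \<and>
        filter (\<lambda>(p, q, r). j \<in> {p, q, r} \<and> k \<in> {p, q, r}) T = [(i, j, k)] \<and>
        filter (\<lambda>(p, q, r). k \<in> {p, q, r} \<and> i \<in> {p, q, r}) T = [(i, j, k)]) \<and>
     (\<forall>l\<in>set [2..<2 * n]. \<exists>(i, j, k)\<in>set T.
        i < l \<and> j < l \<and> k = 2 * n - 1 - l \<or>
        j < l \<and> k < l \<and> i = 2 * n - 1 - l \<or>
        k < l \<and> i < l \<and> j = 2 * n - 1 - l)"

locale weighted_triples_space = coordinatized_space scale n e c
  for scale :: "'a::field \<Rightarrow> 'v::ab_group_add \<Rightarrow> 'v" and n e c +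
  fixes cls :: nat and d :: "nat list" and T :: "(nat \<times> nat \<times> nat) list"
  assumes weighted_triples: "weighted_triples n cls d T"
begin

definition triples_form :: "'v \<Rightarrow> 'v \<Rightarrow> 'v \<Rightarrow> 'a" where
  "triples_form x y z = (\<Sum>(i, j, k)\<leftarrow>T. det3 (c i) (c j) (c k) x y z)"

sublocale trilinear_coordinatized_space scale n e c triples_form
proof
  fix x x' y z r
  show "triples_form (x + x') y z = triples_form x y z + triples_form x' y z"
    unfolding triples_form_def case_prod_beta sum_list_addf[symmetric]
    by (simp add: det3_def coord_add algebra_simps)
  show "triples_form (scale r x) y z = r * triples_form x y z"
    unfolding triples_form_def case_prod_beta sum_list_const_mult[symmetric]
    by (simp add: det3_def coord_scale algebra_simps)
  show "triples_form x y z = triples_form y z x"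
    unfolding triples_form_def
    by (simp add: case_prod_beta det3_def algebra_simps)
  show "triples_form x x z = 0"
    unfolding triples_form_def case_prod_beta
    by (simp add: det3_def algebra_simps)
qed

text \<open>A determinant vanishes on \<open>e i\<close> and \<open>e j\<close> when its triple
  misses \<open>i\<close> or \<open>j\<close>, so only the one triple containing both
  contributes.\<close>

lemma triples_form_eq_det3:
  assumes "filter (\<lambda>(p, q, r). i \<in> {p, q, r} \<and> j \<in> {p, q, r}) T = [(p, q, r)]"
    and "i < 2 * n" "j < 2 * n"
  shows "triples_form (e i) (e j) z = det3 (c p) (c q) (c r) (e i) (e j) z"
proof -
  let ?P = "\<lambda>(p, q, r). i \<in> {p, q, r} \<and> j \<in> {p, q, r}"
  let ?f = "\<lambda>(p, q, r). det3 (c p) (c q) (c r) (e i) (e j) z"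
  have "?f t = 0" if "t \<in> set T" "\<not> ?P t" for t
  proof -
    obtain p q r where t: "t = (p, q, r)" by (cases t)
    then have "p < 2 * n" "q < 2 * n" "r < 2 * n"
      using that(1) weighted_triples by (auto simp: weighted_triples_def)
    then show ?thesis using that(2) assms(2,3) by (auto simp: t det3_def coord_e)
  qed
  then have "sum_list (map ?f (filter ?P T)) = sum_list (map ?f T)" by (rule sum_list_map_filter)
  then have "triples_form (e i) (e j) z = sum_list (map ?f (filter ?P T))"
    by (simp only: triples_form_def)
  then show ?thesis unfolding assms(1) by simp
qed

lemma triples_form_triple:
  assumes "(i, j, k) \<in> set T"
  shows "triples_form (e i) (e j) z = c k z"
    and "triples_form (e j) (e k) z = c i z"
    and "triples_form (e k) (e i) z = c j z"
proof -
  have lt: "i < j" "j < k" "i < k" "i < 2 * n" "j < 2 * n" "k < 2 * n"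
    and filters:
      "filter (\<lambda>(p, q, r). i \<in> {p, q, r} \<and> j \<in> {p, q, r}) T = [(i, j, k)]"
      "filter (\<lambda>(p, q, r). j \<in> {p, q, r} \<and> k \<in> {p, q, r}) T = [(i, j, k)]"
      "filter (\<lambda>(p, q, r). k \<in> {p, q, r} \<and> i \<in> {p, q, r}) T = [(i, j, k)]"
    using assms weighted_triples unfolding weighted_triples_def by fastforce+
  show "triples_form (e i) (e j) z = c k z"
    using lt by (simp add: triples_form_eq_det3[OF filters(1)] det3_def coord_e)
  show "triples_form (e j) (e k) z = c i z"
    using lt by (simp add: triples_form_eq_det3[OF filters(2)] det3_def coord_e)
  show "triples_form (e k) (e i) z = c j z"
    using lt by (simp add: triples_form_eq_det3[OF filters(3)] det3_def coord_e)
qed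

lemma nilpotency_chain_triples:
  "symplectic_alternating_algebra.nilpotency_chain scale product cls
    (\<lambda>s. {x. \<forall>i<2 * n. d ! i + s \<le> cls \<longrightarrow> c i x = 0})"
proof (rule nilpotency_chain_product)
  show "1 \<le> d ! i \<and> d ! i + d ! (2 * n - 1 - i) = cls + 1" if "i < 2 * n" for i
    using weighted_triples that by (simp add: weighted_triples_def)
  fix x y l
  assume l: "l < 2 * n" and x: "\<And>i. i < 2 * n \<Longrightarrow> d ! i + d ! l \<le> cls \<Longrightarrow> c i x = 0"
  have "det3 (c i) (c j) (c k) x y (e l) = 0" if t: "(i, j, k) \<in> set T" for i j k
  proof -
    have lt: "i < 2 * n" "j < 2 * n" "k < 2 * n"
      and weights: "d ! i + d ! j \<le> cls" "d ! i + d ! k \<le> cls" "d ! j + d ! k \<le> cls"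
      using t weighted_triples unfolding weighted_triples_def by fastforce+
    \<comment> \<open>Every term of the determinant has a coordinate of \<open>x\<close> and one of
      \<open>e l\<close> at two different points of the triple. If \<open>l\<close> is the second
      point, the weight condition makes the first factor zero; otherwise the second is zero.\<close>
    have *: "c p x = 0 \<or> c q (e l) = 0" if "d ! p + d ! q \<le> cls" "p < 2 * n" "q < 2 * n" for p q
      using that x l by (auto simp: coord_e)
    have "c i x = 0 \<or> c j (e l) = 0" "c i x = 0 \<or> c k (e l) = 0" "c j x = 0 \<or> c k (e l) = 0"
      "c j x = 0 \<or> c i (e l) = 0" "c k x = 0 \<or> c i (e l) = 0" "c k x = 0 \<or> c j (e l) = 0"
      by (rule *; (use weights lt in \<open>simp add: add.commute\<close>))+
    then show ?thesis unfolding det3_def by auto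
  qed
  then have "map (\<lambda>(i, j, k). det3 (c i) (c j) (c k) x y (e l)) T = map (\<lambda>_. 0) T" by auto
  then show "triples_form x y (e l) = 0" by (simp only: triples_form_def sum_list_0)
qed

lemma hull_e0_e1_triples:
  "symplectic_alternating_algebra.is_subalgebra scale product hull {e 0, e 1} = UNIV"
proof (rule hull_e0_e1)
  fix l assume "2 \<le> l" "l < 2 * n"
  then have "\<exists>(i, j, k)\<in>set T. i < l \<and> j < l \<and> k = 2 * n - 1 - l \<or>
      j < l \<and> k < l \<and> i = 2 * n - 1 - l \<or> k < l \<and> i < l \<and> j = 2 * n - 1 - l"
    using weighted_triples by (simp add: weighted_triples_def)
  then obtain i j k where t: "(i, j, k) \<in> set T"
    and "i < l \<and> j < l \<and> k = 2 * n - 1 - l \<or> j < l \<and> k < l \<and> i = 2 * n - 1 - l \<or>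
      k < l \<and> i < l \<and> j = 2 * n - 1 - l"
    by blast
  then show "\<exists>i<l. \<exists>j<l. \<forall>z. triples_form (e i) (e j) z = c (2 * n - 1 - l) z"
    using triples_form_triple[OF t] by blast
qed

end

text \<open>Minimality compares structures on the same type, so the example is built on the given
  vector space itself, in coordinates with respect to one of its bases.\<close>

lemma nilpotency_class_le_if_weighted_triples:
  fixes scale :: "'a::field \<Rightarrow> 'v::ab_group_add \<Rightarrow> 'v"
  assumes min: "minimal_symplectic_alternating_algebra scale form mult"
    and dim: "vector_space.dim scale (UNIV :: 'v set) = 2 * n" and "0 < n"
    and triples: "weighted_triples n cls d T"
  shows "symplectic_alternating_algebra.nilpotency_class scale mult \<le> cls"
proof -
  interpret L: symplectic_alternating_algebra scale form mult
    using min by (simp add: minimal_symplectic_alternating_algebra_def)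
  obtain B where "finite B" "L.span B = UNIV" using L.finite_dim by blast
  then obtain e c where "coordinatized_space scale n e c"
    using L.ex_coordinatized_space dim by blast
  then interpret weighted_triples_space scale n e c cls d T
    by (simp add: weighted_triples_space_def weighted_triples_space_axioms_def triples)
  interpret M: symplectic_alternating_algebra scale pairing product
    by (rule symplectic_alternating_algebra_product)
  have chain: "\<exists>I. M.nilpotency_chain cls I" using nilpotency_chain_triples by blast
  then have "M.nilpotent_algebra" by (auto simp: M.nilpotent_algebra_def)
  moreover have "M.algebra_rank = 2"
    using hull_e0_e1_triples dim \<open>0 < n\<close> by (intro M.algebra_rank_eq_2) auto
  ultimately have "L.nilpotency_class \<le> M.nilpotency_class"
    using min M.symplectic_alternating_algebra_axioms
    unfolding minimal_symplectic_alternating_algebra_def by blast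
  also have "\<dots> \<le> cls" unfolding M.nilpotency_class_def using chain by (rule Least_le)
  finally show ?thesis .
qed

section \<open>Explicit triple systems for \<open>n = 1\<close> and \<open>n = 4\<close> to
  \<open>n = 8\<close>\<close>

lemma weighted_triples_1: "weighted_triples 1 1 [1, 1] []"
  by code_simp

text \<open>Up to sign, \<open>e 0\<close> times \<open>e 1\<close> is \<open>e 2\<close>,
  \<open>e 0\<close> times \<open>e 2\<close> is \<open>e 4\<close>, and \<open>e 1\<close> times
  \<open>e 2\<close> is \<open>e 3\<close>. The larger systems contain the corresponding triples
  too; these yield the \<open>Omega 3 = 5\<close> vectors of weight at most 3.\<close>

lemma weighted_triples_4:
  "weighted_triples 4 5 [1, 1, 2, 3, 3, 4, 5, 5] [(0, 1, 5), (0, 2, 3), (1, 2, 4)]"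
  by code_simp

text \<open>The triple \<open>(0, 3, 4)\<close> multiplies \<open>e 3\<close> and \<open>e 4\<close>
  by \<open>e 0\<close>, which gives the two vectors of weight 4 up to sign.\<close>

lemma weighted_triples_5:
  "weighted_triples 5 6 [1, 1, 2, 3, 3, 4, 4, 5, 6, 6] [(0, 1, 7), (0, 2, 5), (1, 2, 6), (0, 3, 4)]"
  by code_simp

text \<open>Class 7 makes weight 4 self-dual. The two, four and six vectors of weight 4 in this and
  the next two systems are, up to sign, products of \<open>e 3\<close> or \<open>e 4\<close> with
  \<open>e 0\<close>, \<open>e 1\<close> or \<open>e 2\<close>.\<close>

lemma weighted_triples_6:
  "weighted_triples 6 7 [1, 1, 2, 3, 3, 4, 4, 5, 5, 6, 7, 7]
    [(0, 1, 9), (0, 2, 7), (1, 2, 8), (0, 3, 5), (1, 4, 6)]"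
  by code_simp

lemma weighted_triples_7:
  "weighted_triples 7 7 [1, 1, 2, 3, 3, 4, 4, 4, 4, 5, 5, 6, 7, 7]
    [(0, 1, 11), (0, 2, 9), (1, 2, 10), (0, 3, 5), (1, 3, 6), (0, 4, 7), (1, 4, 8)]"
  by code_simp

text \<open>The last two triples have weights 2, 3, 4, whose sum exceeds \<open>cls + 1\<close>:
  weights need not add up under multiplication, a product only has to outweigh each of its
  factors.\<close>

lemma weighted_triples_8:
  "weighted_triples 8 7 [1, 1, 2, 3, 3, 4, 4, 4, 4, 4, 4, 5, 5, 6, 7, 7]
    [(0, 1, 13), (0, 2, 11), (1, 2, 12), (0, 3, 5), (1, 3, 6), (0, 4, 7), (1, 4, 8), (2, 3, 9),
     (2, 4, 10)]"
  by code_simp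

section \<open>Comparison of the lower and upper bounds\<close>

theorem theorem1p1:
  fixes scale :: "'a::field \<Rightarrow> 'v::ab_group_add \<Rightarrow> 'v"
    and form :: "'v \<Rightarrow> 'v \<Rightarrow> 'a"
    and mult :: "'v \<Rightarrow> 'v \<Rightarrow> 'v"
    and n m :: nat
  assumes "minimal_symplectic_alternating_algebra scale form mult"
    and "vector_space.dim scale (UNIV :: 'v set) = 2 * n"
    and "2 * n \<le> 16"
    and "Omega m < n" and "n \<le> Omega (m + 1)"
  shows "symplectic_alternating_algebra.nilpotency_class scale mult \<le> 7 \<and>
    (real n \<le> (real (Omega m) + real (Omega (m + 1))) / 2 \<longrightarrow>
      symplectic_alternating_algebra.nilpotency_class scale mult = 2 * m + 1) \<and>
    ((real (Omega m) + real (Omega (m + 1))) / 2 < real n \<longrightarrow>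
      symplectic_alternating_algebra.nilpotency_class scale mult = 2 * m + 2)"
proof -
  interpret symplectic_alternating_algebra scale form mult
    using assms(1) by (simp add: minimal_symplectic_alternating_algebra_def)
  have nil: nilpotent_algebra and rank: "algebra_rank = 2"
    using assms(1) by (simp_all add: minimal_symplectic_alternating_algebra_def)
  have dim: "dim (UNIV :: 'v set) = 2 * n" by (rule assms(2))
  let ?cl = nilpotency_class
  have "\<exists>I. nilpotency_chain ?cl I"
    using nil unfolding nilpotent_algebra_def nilpotency_class_def by (rule LeastI_ex)
  then have lcs: "lcs ?cl = {0}" using nilpotency_chain_lcs_eq_0 by blast
  obtain X where "finite X" "card X = algebra_rank" "is_subalgebra hull X = UNIV"
    by (rule algebra_rank_witness)
  then obtain a b where gen: "span ({a, b} \<union> lcs 1) = UNIV"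
    using span_gen_Un_lcs rank by (metis card_2_iff)
  have lower: "2 * n \<le> Omega i + Omega j" if "?cl \<le> i + j" for i j
  proof -
    have "lcs (i + j) = {0}"
      using lcs_antimono[OF that] lcs subspace_0[OF subspace_lcs] by blast
    then have "dim (UNIV :: 'v set) \<le> Omega i + Omega j"
      by (intro dim_le_Omega[OF gen]) (auto simp: card_insert_if)
    then show ?thesis using dim by simp
  qed
  have n: "n \<noteq> 2" "n \<noteq> 3" using not_4_le_dim_le_6[OF lcs gen] dim by auto
  note upper = nilpotency_class_le_if_weighted_triples[OF assms(1,2)]
  have Omega_values: "Omega 1 = 2" "Omega 2 = 3" "Omega 3 = 5" "Omega 4 = 12"
    by code_simp+
  have "m < 4"
  proof (rule ccontr)
    assume "\<not> m < 4"
    have "strict_mono Omega" by (simp add: strict_mono_Suc_iff Omega_less_Suc del: Omega.simps)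
    then have "Omega 4 \<le> Omega m" using \<open>\<not> m < 4\<close> by (simp add: strict_mono_less_eq)
    then show False using assms(3,4) Omega_values by simp
  qed
  then consider "m = 0" | "m = 1" | "m = 2" | "m = 3" by linarith
  then consider "m = 0" "n = 1" | "m = 2" "n = 4" | "m = 2" "n = 5" | "m = 3" "n = 6"
    | "m = 3" "n = 7" | "m = 3" "n = 8"
  proof cases
    case 1
    then have "n = 1" using assms(4,5) n by (simp add: binomial_eq_0)
    then show ?thesis using that 1 by blast
  next
    case 2
    \<comment> \<open>Only \<open>n = 3\<close> lies above \<open>Omega 1 = 2\<close> and not above
      \<open>Omega 2 = 3\<close>, and it is already excluded.\<close>
    then have False using assms(4,5) n Omega_values by (simp add: numeral_2_eq_2 del: Omega.simps)
    then show ?thesis ..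
  next
    case 3
    then have "n = 4 \<or> n = 5" using assms(4,5) Omega_values by simp linarith
    then show ?thesis using that 3 by blast
  next
    case 4
    then have "n = 6 \<or> n = 7 \<or> n = 8" using assms(3,4) Omega_values by simp linarith
    then show ?thesis using that 4 by blast
  qed
  then show ?thesis
  proof cases
    case 1
    have "?cl \<le> 1" using upper weighted_triples_1 1 by simp
    moreover have "?cl \<noteq> 0" using lower[of 0 0] 1 by auto
    ultimately have "?cl = 1" by linarith
    then show ?thesis using 1 by (simp add: binomial_eq_0)
  next
    case 2
    have "?cl \<le> 5" using upper weighted_triples_4 2 by simp
    \<comment> \<open>Class at most 4 would bound the dimension by \<open>2 * Omega 2 = 6\<close>;
      in the cases below, class at most 5 or 6 bounds it by 8 or 10.\<close>
    moreover have "\<not> ?cl \<le> 4" using lower[of 2 2] 2 by (auto simp: Omega_values)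
    ultimately have "?cl = 5" by linarith
    then show ?thesis using 2 by (simp add: Omega_values)
  next
    case 3
    have "?cl \<le> 6" using upper weighted_triples_5 3 by simp
    moreover have "\<not> ?cl \<le> 5" using lower[of 2 3] 3 by (auto simp: Omega_values)
    ultimately have "?cl = 6" by linarith
    then show ?thesis using 3 by (simp add: Omega_values)
  next
    case 4
    have "?cl \<le> 7" using upper weighted_triples_6 4 by simp
    moreover have "\<not> ?cl \<le> 6" using lower[of 3 3] 4 by (auto simp: Omega_values)
    ultimately have "?cl = 7" by linarith
    then show ?thesis using 4 by (simp add: Omega_values)
  next
    case 5
    have "?cl \<le> 7" using upper weighted_triples_7 5 by simp
    moreover have "\<not> ?cl \<le> 6" using lower[of 3 3] 5 by (auto simp: Omega_values)
    ultimately have "?cl = 7" by linarith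
    then show ?thesis using 5 by (simp add: Omega_values)
  next
    case 6
    have "?cl \<le> 7" using upper weighted_triples_8 6 by simp
    moreover have "\<not> ?cl \<le> 6" using lower[of 3 3] 6 by (auto simp: Omega_values)
    ultimately have "?cl = 7" by linarith
    then show ?thesis using 6 by (simp add: Omega_values)
  qed
qed

end
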